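(* Let $G=(V,E)$ be a connected split graph and $t\in V$. Then $t$ is the last vertex of some MCS ordering of $G$ if and only if (1) $t$ is simplicial, and (2) the neighbourhoods $N(v)$ of the vertices $v$ with $\deg(v)<\deg(t)$ are totally ordered by inclusion.
   Context: A split graph is a graph whose vertex set can be partitioned into a clique and an independent set. A vertex is simplicial if its neighbourhood is a clique. An MCS ordering of a graph with $n$ vertices is any ordering produced by: the first vertex is arbitrary; at each subsequent step, number next an unnumbered vertex having the largest number of already numbered neighbours (any tie-break allowed). *)

theory Defs
  imports "Graph_Theory.Graph_Theory"
begin

text \<open>
  Finite simple graphs are those of the locale \<^locale>\<open>graph\<close>: finite, loop-free symmetric
  digraphs without multiple arcs. An undirected edge is thus a pair of opposite arcs.
\<close>

definition neighbourhood :: "('a, 'b) pre_digraph \<Rightarrow> 'a \<Rightarrow> 'a set" where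
  "neighbourhood G v = {w. v \<rightarrow>\<^bsub>G\<^esub> w}"

definition clique :: "('a, 'b) pre_digraph \<Rightarrow> 'a set \<Rightarrow> bool" where
  "clique G K \<longleftrightarrow> K \<subseteq> verts G \<and> (\<forall>u\<in>K. \<forall>v\<in>K. u \<noteq> v \<longrightarrow> u \<rightarrow>\<^bsub>G\<^esub> v)"

definition independent_set :: "('a, 'b) pre_digraph \<Rightarrow> 'a set \<Rightarrow> bool" where
  "independent_set G I \<longleftrightarrow> I \<subseteq> verts G \<and> (\<forall>u\<in>I. \<forall>v\<in>I. \<not> u \<rightarrow>\<^bsub>G\<^esub> v)"

text \<open>Either part may be empty, so complete graphs and edgeless graphs are split.\<close>

definition split_graph :: "('a, 'b) pre_digraph \<Rightarrow> bool" where
  "split_graph G \<longleftrightarrow>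
    (\<exists>K I. K \<union> I = verts G \<and> K \<inter> I = {} \<and> clique G K \<and> independent_set G I)"

definition simplicial :: "('a, 'b) pre_digraph \<Rightarrow> 'a \<Rightarrow> bool" where
  "simplicial G v \<longleftrightarrow> v \<in> verts G \<and> clique G (neighbourhood G v)"

text \<open>
  At position \<open>i\<close> the already numbered vertices are those in \<open>take i xs\<close>. For \<open>i = 0\<close> both
  cardinalities are \<open>0\<close>, so the first vertex is unconstrained.
\<close>

definition mcs_ordering :: "('a, 'b) pre_digraph \<Rightarrow> 'a list \<Rightarrow> bool" where
  "mcs_ordering G xs \<longleftrightarrow> distinct xs \<and> set xs = verts G \<and>
    (\<forall>i<length xs. \<forall>w \<in> verts G - set (take i xs).
       card (neighbourhood G w \<inter> set (take i xs))
         \<le> card (neighbourhood G (xs ! i) \<inter> set (take i xs)))"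

text \<open>The degree of a vertex of an undirected graph is its out-degree here:\<close>

lemma (in graph) out_degree_eq_card_neighbourhood:
  "out_degree G v = card (neighbourhood G v)"
proof -
  have "inj_on (head G) (out_arcs G v)"
    by (rule inj_onI) (auto intro: no_multi_arcs simp: arc_to_ends_def)
  moreover have "head G ` out_arcs G v = neighbourhood G v"
    by (auto simp: neighbourhood_def arcs_ends_conv)
  ultimately show ?thesis
    unfolding out_degree_def by (metis card_image)
qed

end

theory Submission
  imports Defs
begin

text \<open>
  A simplicial vertex of a split graph can be moved into the independent part \<open>I\<close> of a split
  partition. If a vertex \<open>w\<close> of \<open>I\<close> is numbered while some vertex of the clique \<open>K\<close> is still
  unnumbered, then counting numbered neighbours shows that \<open>w\<close> sees all numbered vertices of \<open>K\<close>,
  while unnumbered vertices of \<open>K\<close> see no numbered vertex of \<open>I\<close>. Hence the vertices of \<open>I\<close>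
  numbered before \<open>K\<close> is exhausted have increasing neighbourhoods, and the vertices numbered after
  that come in decreasing order of degree, so that every vertex of degree less than that of the last
  vertex belongs to the first group. Conversely, such a chain can be numbered along with its
  neighbourhoods, followed by the rest of \<open>K\<close> and then the rest of \<open>I\<close> by decreasing degree.
\<close>

section \<open>Sets of vertices that a search can have numbered\<close>

text \<open>Which vertices may come next depends only on the set numbered so far. Constructions can
  therefore work with sets and forget the order; \<open>mcs_reachable_prefix\<close> recovers a
  list.\<close>

inductive mcs_reachable :: "('a, 'b) pre_digraph \<Rightarrow> 'a set \<Rightarrow> bool" for G where
  empty: "mcs_reachable G {}"
| step: "mcs_reachable G S \<Longrightarrow> y \<in> verts G - S \<Longrightarrow>
    (\<And>w. w \<in> verts G - S \<Longrightarrow> card (neighbourhood G w \<inter> S) \<le> card (neighbourhood G y \<inter> S)) \<Longrightarrow>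
    mcs_reachable G (insert y S)"

definition mcs_prefix :: "('a, 'b) pre_digraph \<Rightarrow> 'a list \<Rightarrow> bool" where
  "mcs_prefix G xs \<longleftrightarrow> distinct xs \<and> set xs \<subseteq> verts G \<and>
    (\<forall>i<length xs. \<forall>w \<in> verts G - set (take i xs).
       card (neighbourhood G w \<inter> set (take i xs))
         \<le> card (neighbourhood G (xs ! i) \<inter> set (take i xs)))"

lemma mcs_ordering_iff_prefix: "mcs_ordering G xs \<longleftrightarrow> mcs_prefix G xs \<and> set xs = verts G"
  unfolding mcs_ordering_def mcs_prefix_def by auto

lemma mcs_prefix_append:
  assumes "mcs_prefix G xs" "y \<in> verts G - set xs"
    and "\<And>w. w \<in> verts G - set xs \<Longrightarrow>
      card (neighbourhood G w \<inter> set xs) \<le> card (neighbourhood G y \<inter> set xs)"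
  shows "mcs_prefix G (xs @ [y])"
proof -
  have "card (neighbourhood G w \<inter> set (take i (xs @ [y])))
      \<le> card (neighbourhood G ((xs @ [y]) ! i) \<inter> set (take i (xs @ [y])))"
    if "i < length (xs @ [y])" and w: "w \<in> verts G - set (take i (xs @ [y]))" for i w
  proof (cases "i < length xs")
    case True
    then show ?thesis using assms(1) w by (simp add: mcs_prefix_def nth_append)
  next
    case False
    then have "i = length xs" using that(1) by simp
    then show ?thesis using assms(3) w by simp
  qed
  moreover have "distinct (xs @ [y])" "set (xs @ [y]) \<subseteq> verts G"
    using assms(1,2) by (auto simp: mcs_prefix_def)
  ultimately show ?thesis unfolding mcs_prefix_def by blast
qed

lemma mcs_reachable_prefix:
  assumes "mcs_reachable G S"
  shows "\<exists>xs. mcs_prefix G xs \<and> set xs = S"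
  using assms
proof induction
  case empty
  then show ?case by (simp add: mcs_prefix_def)
next
  case (step S y)
  from step.IH obtain xs where xs: "mcs_prefix G xs" "set xs = S" by (elim exE conjE)
  then have "mcs_prefix G (xs @ [y])"
    using step.hyps by (intro mcs_prefix_append) auto
  then show ?case
    using xs by (intro exI[of _ "xs @ [y]"]) auto
qed

text \<open>Once \<open>t\<close> is the only unnumbered vertex, maximality compares
  \<open>t\<close> with itself alone.\<close>

lemma mcs_ordering_last_if_reachable:
  assumes "mcs_reachable G (verts G - {t})" and "t \<in> verts G"
  shows "\<exists>xs. mcs_ordering G xs \<and> last xs = t"
proof -
  from mcs_reachable_prefix[OF assms(1)] obtain xs
    where xs: "mcs_prefix G xs" "set xs = verts G - {t}" by (elim exE conjE)
  then have "mcs_prefix G (xs @ [t])"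
    using assms(2) by (intro mcs_prefix_append) auto
  then have "mcs_ordering G (xs @ [t])"
    using xs assms(2) by (auto simp: mcs_ordering_iff_prefix)
  then show ?thesis by (intro exI[of _ "xs @ [t]"]) simp
qed

section \<open>Neighbourhoods and split partitions\<close>

context graph
begin

lemma neighbourhood_sym: "u \<in> neighbourhood G v \<longleftrightarrow> v \<in> neighbourhood G u"
  using arcs_ends_symmetric[OF sym_arcs] by (auto simp: neighbourhood_def)

lemma not_in_own_neighbourhood [simp]: "v \<notin> neighbourhood G v"
  by (auto simp: neighbourhood_def dest: adj_not_same)

lemma neighbourhood_subset_verts: "neighbourhood G v \<subseteq> verts G"
  by (auto simp: neighbourhood_def dest: adj_in_verts)

lemma finite_neighbourhood [simp]: "finite (neighbourhood G v)"
  using finite_subset[OF neighbourhood_subset_verts] by simp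

lemma clique_iff_neighbourhood:
  "clique G C \<longleftrightarrow> C \<subseteq> verts G \<and> (\<forall>u\<in>C. \<forall>v\<in>C. u \<noteq> v \<longrightarrow> v \<in> neighbourhood G u)"
  by (auto simp: clique_def neighbourhood_def)

lemma independent_set_iff_neighbourhood:
  "independent_set G J \<longleftrightarrow> J \<subseteq> verts G \<and> (\<forall>u\<in>J. \<forall>v\<in>J. v \<notin> neighbourhood G u)"
  by (auto simp: independent_set_def neighbourhood_def)

end

text \<open>The parts are parameters because a split graph can have several partitions, and the
  final proof switches to one whose independent part contains \<open>t\<close>.\<close>

locale split_partition = graph G for G :: "('a, 'b) pre_digraph" (structure) +
  fixes K I :: "'a set"
  assumes union: "K \<union> I = verts G"
    and disjoint: "K \<inter> I = {}"
    and clique: "clique G K"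
    and independent: "independent_set G I"
begin

lemma finite_K [simp]: "finite K" and finite_I [simp]: "finite I"
  using union finite_verts by (metis finite_Un)+

lemma neighbourhood_I: "v \<in> I \<Longrightarrow> neighbourhood G v \<subseteq> K"
  using independent neighbourhood_subset_verts[of v] union
  by (auto simp: independent_set_iff_neighbourhood)

lemma K_adjacent: "u \<in> K \<Longrightarrow> v \<in> K \<Longrightarrow> u \<noteq> v \<Longrightarrow> v \<in> neighbourhood G u"
  using clique by (auto simp: clique_iff_neighbourhood)

lemma simplicial_I:
  assumes "t \<in> I"
  shows "simplicial G t"
  using assms neighbourhood_I[OF assms] K_adjacent union
  unfolding simplicial_def clique_iff_neighbourhood by blast

text \<open>All neighbours of \<open>t\<close> lie in \<open>K\<close>, so \<open>v\<close> is
  adjacent to each of them except possibly itself; if \<open>v\<close> is one of them,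
  \<open>t\<close> replaces it as a neighbour of \<open>v\<close>. Consequently all vertices of
  degree less than that of \<open>t\<close> lie in \<open>I\<close>.\<close>

lemma degree_I_le_degree_K:
  assumes "t \<in> I" "v \<in> K"
  shows "card (neighbourhood G t) \<le> card (neighbourhood G v)"
proof (cases "v \<in> neighbourhood G t")
  case True
  have "insert t (neighbourhood G t - {v}) \<subseteq> neighbourhood G v"
    using True assms neighbourhood_I[OF assms(1)] K_adjacent neighbourhood_sym by blast
  then have "card (insert t (neighbourhood G t - {v})) \<le> card (neighbourhood G v)"
    by (intro card_mono) auto
  then show ?thesis
    using True by (simp add: card_Suc_Diff1 del: card_Diff_insert)
next
  case False
  have "neighbourhood G t \<subseteq> neighbourhood G v"
    using False neighbourhood_I[OF assms(1)] K_adjacent assms(2) by blast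
  then show ?thesis by (intro card_mono) auto
qed

section \<open>Necessity: what an ordering ending in \<open>t\<close> forces\<close>

text \<open>The unnumbered \<open>x\<close> sees every numbered vertex of \<open>K\<close>, and
  possibly some of \<open>I\<close>; the chosen vertex sees numbered vertices of \<open>K\<close>
  only. Since \<open>x\<close> was a candidate too, the two counts must agree.\<close>

lemma numbered_before_clique_exhausted:
  assumes mcs: "mcs_ordering G xs" and i: "i < length xs" and w: "xs ! i \<in> I"
    and x: "x \<in> K" "x \<notin> set (take i xs)"
  shows "K \<inter> set (take i xs) \<subseteq> neighbourhood G (xs ! i)"
    and "neighbourhood G x \<inter> set (take i xs) \<inter> I = {}"
proof -
  let ?S = "set (take i xs)" and ?w = "xs ! i"
  have S: "?S \<subseteq> verts G"
    using mcs set_take_subset[of i xs] by (auto simp: mcs_ordering_def)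
  have x_nbrs: "neighbourhood G x \<inter> ?S = (K \<inter> ?S) \<union> (neighbourhood G x \<inter> ?S \<inter> I)"
    using x S union K_adjacent by blast
  have "card (neighbourhood G x \<inter> ?S) = card (K \<inter> ?S) + card (neighbourhood G x \<inter> ?S \<inter> I)"
    by (subst x_nbrs, intro card_Un_disjoint) (use disjoint in auto)
  moreover have "card (neighbourhood G x \<inter> ?S) \<le> card (neighbourhood G ?w \<inter> ?S)"
    using mcs i x union unfolding mcs_ordering_def by blast
  moreover have w_nbrs: "neighbourhood G ?w \<inter> ?S \<subseteq> K \<inter> ?S"
    using neighbourhood_I[OF w] by blast
  moreover have "card (neighbourhood G ?w \<inter> ?S) \<le> card (K \<inter> ?S)"
    using w_nbrs by (intro card_mono) auto
  ultimately have "card (neighbourhood G x \<inter> ?S \<inter> I) = 0"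
    and "card (neighbourhood G ?w \<inter> ?S) = card (K \<inter> ?S)"
    by linarith+
  then show "neighbourhood G x \<inter> ?S \<inter> I = {}" "K \<inter> ?S \<subseteq> neighbourhood G ?w"
    using card_subset_eq[OF _ w_nbrs] by auto
qed

text \<open>The clique vertex \<open>t\<close> stays unnumbered to the end, so it has at most one
  neighbour in \<open>I\<close>, and that neighbour turns out to be adjacent to all of
  \<open>K\<close>. Together with \<open>K - {t}\<close> it forms a clique.\<close>

lemma simplicial_last_K:
  assumes mcs: "mcs_ordering G xs" and last: "last xs = t" and t: "t \<in> K"
  shows "simplicial G t"
proof -
  have xs: "distinct xs" "set xs = verts G"
    using mcs by (auto simp: mcs_ordering_def)
  have ne: "xs \<noteq> []" using xs t union by auto
  have t_nth: "t = xs ! (length xs - 1)"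
    using last ne by (simp add: last_conv_nth)
  have t_late: "t \<notin> set (take i xs)" if "i < length xs" for i
    using that xs(1) unfolding t_nth by (auto simp: in_set_conv_nth nth_eq_iff_index_eq)
  have numbered: "xs ! i \<in> set (take j xs)" if "i < j" "j < length xs" for i j
    using that by (auto simp: in_set_conv_nth)
  \<comment> \<open>Numbering \<open>xs ! j\<close> while \<open>t\<close> is open forbids
    \<open>t\<close> to have an already numbered neighbour in \<open>I\<close>.\<close>
  have one: False
    if "i < j" "j < length xs" "xs ! i \<in> I" "xs ! j \<in> I" "xs ! i \<in> neighbourhood G t" for i j
    using numbered_before_clique_exhausted(2)[OF mcs that(2,4) t t_late[OF that(2)]]
      numbered[OF that(1,2)] that(3,5) by blast
  have I_nbr_unique: "u = u'"
    if "u \<in> I" "u' \<in> I" "u \<in> neighbourhood G t" "u' \<in> neighbourhood G t" for u u'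
  proof -
    have "u \<in> set xs" "u' \<in> set xs" using that(1,2) union xs(2) by auto
    then obtain i j where "i < length xs" "u = xs ! i" "j < length xs" "u' = xs ! j"
      unfolding in_set_conv_nth by (elim exE conjE) simp
    then show ?thesis using one[of i j] one[of j i] that
      by (cases i j rule: linorder_cases) auto
  qed
  have I_nbr_complete: "k \<in> neighbourhood G u"
    if u: "u \<in> I" "u \<in> neighbourhood G t" and k: "k \<in> K" for u k
  proof (rule ccontr)
    assume non: "k \<notin> neighbourhood G u"
    have "u \<in> set xs" "k \<in> set xs" using u(1) k union xs(2) by auto
    then obtain i j where i: "i < length xs" "u = xs ! i" and j: "j < length xs" "k = xs ! j"
      unfolding in_set_conv_nth by (elim exE conjE) simp
    note at_u = numbered_before_clique_exhausted[OF mcs i(1) u(1)[unfolded i(2)]]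
    \<comment> \<open>When \<open>u\<close> is chosen, \<open>t\<close> is still open, so
      \<open>u\<close> sees every numbered vertex of \<open>K\<close>. The non-neighbour
      \<open>k\<close> must therefore come later.\<close>
    have "k \<notin> set (take i xs)"
      using at_u(1)[OF t t_late[OF i(1)]] k non i(2) by blast
    then have ij: "i < j"
      using numbered[of j i] i j disjoint k u by (metis IntI empty_iff linorder_neqE_nat)
    let ?S = "set (take j xs)"
    have S: "?S \<subseteq> verts G" using xs(2) set_take_subset[of j xs] by auto
    have uS: "u \<in> ?S" using numbered[OF ij j(1)] i by simp
    \<comment> \<open>Vertices of \<open>I\<close> numbered before \<open>u\<close> are not adjacent
      to \<open>k\<close>, as \<open>k\<close> was open when \<open>u\<close> was chosen; after
      \<open>u\<close>, no vertex of \<open>I\<close> is numbered at all, by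
      \<open>one\<close>.\<close>
    have k_nbrs: "neighbourhood G k \<inter> ?S \<subseteq> K \<inter> ?S"
    proof
      fix w assume w: "w \<in> neighbourhood G k \<inter> ?S"
      have "w \<notin> I"
      proof
        assume wI: "w \<in> I"
        obtain m where m: "m < j" "w = xs ! m"
          using w j(1) by (auto simp: in_set_conv_nth)
        have "w \<noteq> u" using w non neighbourhood_sym by blast
        then consider "m < i" | "i < m"
          using m i by (metis linorder_neqE_nat)
        then show False
        proof cases
          case 1
          then show False
            using at_u(2)[OF k \<open>k \<notin> set (take i xs)\<close>] numbered[OF 1 i(1)] w m wI by auto
        next
          case 2
          then show False using one[of i m] m j i u wI by auto
        qed
      qed
      then show "w \<in> K \<inter> ?S" using w S union by blast
    qed
    \<comment> \<open>At the turn of \<open>k\<close>, the vertex \<open>t\<close> has the extra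
      numbered neighbour \<open>u\<close> and should have been preferred.\<close>
    have "insert u (K \<inter> ?S) \<subseteq> neighbourhood G t \<inter> ?S"
      using uS u(2) K_adjacent[OF t] t_late[OF j(1)] by blast
    then have "card (insert u (K \<inter> ?S)) \<le> card (neighbourhood G t \<inter> ?S)"
      by (intro card_mono) auto
    moreover have "card (insert u (K \<inter> ?S)) = Suc (card (K \<inter> ?S))"
      using u(1) disjoint by (intro card_insert_disjoint) auto
    moreover have "card (neighbourhood G t \<inter> ?S) \<le> card (neighbourhood G k \<inter> ?S)"
      using mcs j t_late[OF j(1)] t union unfolding mcs_ordering_def by blast
    moreover have "card (neighbourhood G k \<inter> ?S) \<le> card (K \<inter> ?S)"
      using k_nbrs by (intro card_mono) auto
    ultimately show False by linarith
  qed
  have "v \<in> neighbourhood G u"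
    if "u \<in> neighbourhood G t" "v \<in> neighbourhood G t" "u \<noteq> v" for u v
  proof -
    have "u \<in> K \<union> I" "v \<in> K \<union> I"
      using that neighbourhood_subset_verts union by auto
    then show ?thesis
      using that I_nbr_unique[of u v] I_nbr_complete[of u v] I_nbr_complete[of v u]
        K_adjacent[of u v] neighbourhood_sym[of u v] by blast
  qed
  then show ?thesis
    using t union neighbourhood_subset_verts[of t]
    unfolding simplicial_def clique_iff_neighbourhood by blast
qed

text \<open>The vertices concerned lie in \<open>I\<close> by \<open>degree_I_le_degree_K\<close>,
  and their neighbourhoods grow in the order of numbering.\<close>

lemma chain_of_smaller_degree:
  assumes mcs: "mcs_ordering G xs" and last: "last xs = t" and t: "t \<in> I"
  shows "chain_subset (neighbourhood G ` {v \<in> verts G. out_degree G v < out_degree G t})"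
proof -
  have xs: "distinct xs" "set xs = verts G"
    using mcs by (auto simp: mcs_ordering_def)
  have ne: "xs \<noteq> []" using xs t union by auto
  have t_nth: "t = xs ! (length xs - 1)"
    using last ne by (simp add: last_conv_nth)
  have t_late: "t \<notin> set (take i xs)" if "i < length xs" for i
    using that xs(1) unfolding t_nth by (auto simp: in_set_conv_nth nth_eq_iff_index_eq)
  have numbered: "xs ! i \<in> set (take j xs)" if "i < j" "j < length xs" for i j
    using that by (auto simp: in_set_conv_nth)
  have ordered: "neighbourhood G (xs ! i) \<subseteq> neighbourhood G (xs ! j)"
    if ij: "i < j" "j < length xs" and I: "xs ! i \<in> I" "xs ! j \<in> I"
      and small: "card (neighbourhood G (xs ! j)) < card (neighbourhood G t)" for i j
  proof -
    let ?S = "set (take j xs)"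
    \<comment> \<open>With \<open>K\<close> exhausted, numbered neighbours of vertices of
      \<open>I\<close> count the full degree, so \<open>t\<close> would beat
      \<open>xs ! j\<close>.\<close>
    have "\<not> K \<subseteq> ?S"
    proof
      assume "K \<subseteq> ?S"
      then have "neighbourhood G (xs ! j) \<inter> ?S = neighbourhood G (xs ! j)"
        "neighbourhood G t \<inter> ?S = neighbourhood G t"
        using neighbourhood_I I(2) t by blast+
      moreover have "card (neighbourhood G t \<inter> ?S) \<le> card (neighbourhood G (xs ! j) \<inter> ?S)"
        using mcs ij t_late[OF ij(2)] t union unfolding mcs_ordering_def by blast
      ultimately show False using small by simp
    qed
    then obtain x where x: "x \<in> K" "x \<notin> ?S" by blast
    \<comment> \<open>Otherwise \<open>y\<close> would be an open clique vertex with the numbered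
      neighbour \<open>xs ! i\<close> in \<open>I\<close>.\<close>
    have "y \<in> ?S" if "y \<in> neighbourhood G (xs ! i)" for y
    proof (rule ccontr)
      assume "y \<notin> ?S"
      moreover have "y \<in> K" using that neighbourhood_I[OF I(1)] by blast
      ultimately show False
        using numbered_before_clique_exhausted(2)[OF mcs ij(2) I(2)] numbered[OF ij] that I(1)
          neighbourhood_sym by blast
    qed
    then show ?thesis
      using numbered_before_clique_exhausted(1)[OF mcs ij(2) I(2) x] neighbourhood_I[OF I(1)]
      by blast
  qed
  show ?thesis
    unfolding chain_subset_def
  proof (intro ballI)
    fix A B
    assume A: "A \<in> neighbourhood G ` {v \<in> verts G. out_degree G v < out_degree G t}"
      and B: "B \<in> neighbourhood G ` {v \<in> verts G. out_degree G v < out_degree G t}"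
    obtain u where u: "A = neighbourhood G u" "u \<in> verts G" "card A < card (neighbourhood G t)"
      using A unfolding out_degree_eq_card_neighbourhood by blast
    obtain v where v: "B = neighbourhood G v" "v \<in> verts G" "card B < card (neighbourhood G t)"
      using B unfolding out_degree_eq_card_neighbourhood by blast
    note uv = u v
    have uvI: "u \<in> I" "v \<in> I"
      using uv degree_I_le_degree_K[OF t] union by (metis UnE not_le)+
    obtain i j where ij: "i < length xs" "u = xs ! i" "j < length xs" "v = xs ! j"
      using uv xs(2) by (metis in_set_conv_nth)
    consider "i < j" | "j < i" | "i = j" by linarith
    then show "A \<subseteq> B \<or> B \<subseteq> A"
      using ordered[of i j] ordered[of j i] ij uv uvI by cases auto
  qed
qed

section \<open>Sufficiency: constructing an ordering that ends in \<open>t\<close>\<close>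

text \<open>The numbered vertices of \<open>I\<close> have no open neighbours, so an open vertex
  sees only numbered vertices of \<open>K\<close>. Every open clique vertex sees all of these and is
  a legal choice.\<close>

lemma mcs_reachable_add_clique:
  assumes "mcs_reachable G (C \<union> J)" "C \<subseteq> K" "J \<subseteq> I" "\<And>j. j \<in> J \<Longrightarrow> neighbourhood G j \<subseteq> C"
    and "D \<subseteq> K"
  shows "mcs_reachable G (D \<union> C \<union> J)"
  using finite_subset[OF assms(5) finite_K] assms(5)
proof (induction D rule: finite_induct)
  case empty
  then show ?case using assms(1) by simp
next
  case (insert y D)
  let ?S = "D \<union> C \<union> J"
  have fin: "finite (D \<union> C)"
    using insert.prems assms(2) by (meson finite_K finite_subset le_supI insert_subset)
  show ?case
  proof (cases "y \<in> C")
    case True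
    then show ?thesis using insert by (simp add: insert_absorb)
  next
    case False
    have "mcs_reachable G (insert y ?S)"
    proof (rule mcs_reachable.step)
      show "mcs_reachable G ?S" using insert by simp
      show "y \<in> verts G - ?S"
        using False insert assms(3) disjoint union by blast
      fix w assume w: "w \<in> verts G - ?S"
      have "neighbourhood G w \<inter> ?S \<subseteq> D \<union> C"
      proof (cases "w \<in> K")
        case True
        then show ?thesis using assms(4) w neighbourhood_sym by blast
      next
        case False
        then show ?thesis using neighbourhood_I[of w] w union assms(3) disjoint by blast
      qed
      moreover have "D \<union> C \<subseteq> neighbourhood G y"
        using K_adjacent[of y] insert.hyps insert.prems assms(2) False by blast
      ultimately have "neighbourhood G w \<inter> ?S \<subseteq> neighbourhood G y \<inter> ?S" by blast
      then show "card (neighbourhood G w \<inter> ?S) \<le> card (neighbourhood G y \<inter> ?S)"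
        by (intro card_mono) auto
    qed
    then show ?thesis by simp
  qed
qed

text \<open>The induction adds vertices by increasing degree; in a chain, the neighbourhood of
  largest cardinality contains all the others.\<close>

lemma mcs_reachable_chain:
  assumes "F \<subseteq> I" "chain_subset (neighbourhood G ` F)"
  shows "mcs_reachable G (\<Union>(neighbourhood G ` F) \<union> F)"
  using finite_subset[OF assms(1) finite_I] assms
proof (induction F rule: finite_ranking_induct[where f = "\<lambda>v. card (neighbourhood G v)"])
  case empty
  then show ?case by (simp add: mcs_reachable.empty)
next
  case (insert x F)
  let ?C = "\<Union>(neighbourhood G ` F)" and ?N = "neighbourhood G x"
  have reach: "mcs_reachable G (?C \<union> F)"
    using insert by (auto simp: chain_subset_def)
  have below: "neighbourhood G y \<subseteq> ?N" if "y \<in> F" for y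
  proof -
    have "neighbourhood G y \<subseteq> ?N \<or> ?N \<subseteq> neighbourhood G y"
      using insert.prems(2) that by (auto simp: chain_subset_def)
    then show ?thesis
      using insert.hyps(2)[OF that] by (metis card_seteq finite_neighbourhood order_refl)
  qed
  show ?case
  proof (cases "x \<in> F")
    case True
    then show ?thesis using reach by (simp add: insert_absorb)
  next
    case False
    have x: "x \<in> I" and F: "F \<subseteq> I" using insert.prems by auto
    have C: "?C \<subseteq> ?N" using below by blast
    have NK: "?N \<subseteq> K" by (rule neighbourhood_I[OF x])
    \<comment> \<open>The missing vertices of \<open>?N\<close> come first. The numbered part of
      \<open>K\<close> is then exactly \<open>?N\<close>, so \<open>x\<close> sees all of it and may
      follow.\<close>
    have "mcs_reachable G (?N \<union> ?C \<union> F)"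
      using C NK F by (intro mcs_reachable_add_clique reach) auto
    then have N: "mcs_reachable G (?N \<union> F)" using C by (simp add: Un_absorb2)
    have "mcs_reachable G (insert x (?N \<union> F))"
    proof (rule mcs_reachable.step[OF N])
      show "x \<in> verts G - (?N \<union> F)" using False x union by auto
      fix w assume w: "w \<in> verts G - (?N \<union> F)"
      have "neighbourhood G w \<inter> (?N \<union> F) \<subseteq> ?N"
      proof (cases "w \<in> K")
        case True
        then show ?thesis using below w neighbourhood_sym by blast
      next
        case False
        then show ?thesis using neighbourhood_I[of w] w union F disjoint by blast
      qed
      then have "neighbourhood G w \<inter> (?N \<union> F) \<subseteq> ?N \<inter> (?N \<union> F)" by blast
      then show "card (neighbourhood G w \<inter> (?N \<union> F)) \<le> card (?N \<inter> (?N \<union> F))"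
        by (intro card_mono) auto
    qed
    moreover have "\<Union>(neighbourhood G ` insert x F) \<union> insert x F = insert x (?N \<union> F)"
      using C by auto
    ultimately show ?thesis by simp
  qed
qed

text \<open>\<open>R\<close> holds the vertices other than \<open>t\<close> still to be numbered. As
  \<open>K\<close> is numbered, the counts on \<open>I\<close> are degrees, so a vertex of largest
  degree in \<open>R\<close> may come next, even in competition with \<open>t\<close>. Passing to
  the smaller \<open>R\<close> of the induction hypothesis means moving forward in the
  search.\<close>

lemma mcs_reachable_by_decreasing_degree:
  assumes "t \<in> I" and "R \<subseteq> I - {t}"
    and "\<And>r. r \<in> R \<Longrightarrow> card (neighbourhood G t) \<le> card (neighbourhood G r)"
    and "mcs_reachable G (K \<union> (I - insert t R))"
  shows "mcs_reachable G (verts G - {t})"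
proof -
  have "finite R" using finite_subset[OF assms(2)] by simp
  then show ?thesis using assms(2-4)
  proof (induction R rule: finite_ranking_induct[where f = "\<lambda>v. card (neighbourhood G v)"])
    case empty
    moreover have "K \<union> (I - {t}) = verts G - {t}"
      using assms(1) union disjoint by blast
    ultimately show ?case by simp
  next
    case (insert x R)
    show ?case
    proof (cases "x \<in> R")
      case True
      then show ?thesis using insert by (simp add: insert_absorb)
    next
      case False
      let ?S = "K \<union> (I - insert t (insert x R))"
      have x: "x \<in> I" "x \<noteq> t" using insert.prems by auto
      have "mcs_reachable G (insert x ?S)"
      proof (rule mcs_reachable.step)
        show "mcs_reachable G ?S" by (rule insert.prems(3))
        show "x \<in> verts G - ?S" using x union disjoint by blast
        fix w assume w: "w \<in> verts G - ?S"
        then have w': "w \<in> insert t (insert x R)" "w \<in> I" using union by blast+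
        then have "neighbourhood G w \<inter> ?S = neighbourhood G w"
          "neighbourhood G x \<inter> ?S = neighbourhood G x"
          using neighbourhood_I[of w] neighbourhood_I[of x] x by blast+
        moreover have "card (neighbourhood G w) \<le> card (neighbourhood G x)"
          using w' insert.hyps(2) insert.prems(2) by auto
        ultimately show "card (neighbourhood G w \<inter> ?S) \<le> card (neighbourhood G x \<inter> ?S)"
          by simp
      qed
      moreover have "insert x ?S = K \<union> (I - insert t R)"
        using x False by blast
      ultimately show ?thesis
        using insert.IH insert.prems by auto
    qed
  qed
qed

lemma mcs_last_if_chain:
  assumes t: "t \<in> I"
    and chain: "chain_subset (neighbourhood G ` {v \<in> verts G. out_degree G v < out_degree G t})"
  shows "\<exists>xs. mcs_ordering G xs \<and> last xs = t"
proof -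
  define L where "L = {v \<in> verts G. out_degree G v < out_degree G t}"
  have L: "L \<subseteq> I"
    using degree_I_le_degree_K[OF t] union
    by (fastforce simp: L_def out_degree_eq_card_neighbourhood)
  let ?C = "\<Union>(neighbourhood G ` L)"
  have C: "?C \<subseteq> K" using L neighbourhood_I by blast
  have "mcs_reachable G (K \<union> ?C \<union> L)"
    using C L chain
    by (intro mcs_reachable_add_clique mcs_reachable_chain) (auto simp: L_def)
  \<comment> \<open>What remains besides \<open>t\<close> is \<open>I - {t} - L\<close>, whose
    vertices have degree at least that of \<open>t\<close> by the choice of
    \<open>L\<close>.\<close>
  moreover have "K \<union> ?C \<union> L = K \<union> (I - insert t (I - {t} - L))"
    using C L by (auto simp: L_def)
  ultimately have "mcs_reachable G (verts G - {t})"
    using union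
    by (intro mcs_reachable_by_decreasing_degree[OF t, of "I - {t} - L"])
      (auto simp: L_def out_degree_eq_card_neighbourhood)
  then show ?thesis
    using t union by (intro mcs_ordering_last_if_reachable) auto
qed

section \<open>Change of partition and the equivalence\<close>

lemma simplicial_in_independent_part:
  assumes simp: "simplicial G t"
  obtains K' I' where "split_partition G K' I'" "t \<in> I'"
proof (cases "t \<in> I")
  case True
  then show ?thesis using that split_partition_axioms by blast
next
  case False
  have tK: "t \<in> K" using False simp union by (auto simp: simplicial_def)
  have nbrs: "v \<in> neighbourhood G u"
    if "u \<in> neighbourhood G t" "v \<in> neighbourhood G t" "u \<noteq> v" for u v
    using simp that by (auto simp: simplicial_def clique_iff_neighbourhood)
  \<comment> \<open>\<open>t\<close> has at most one neighbour in \<open>I\<close>, and exchanges its place with it.\<close>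
  define U where "U = neighbourhood G t \<inter> I"
  show ?thesis
  proof (rule that)
    show "t \<in> insert t (I - U)" by simp
    show "split_partition G (K - {t} \<union> U) (insert t (I - U))"
    proof unfold_locales
      show "K - {t} \<union> U \<union> insert t (I - U) = verts G"
        using tK union by (auto simp: U_def)
      show "(K - {t} \<union> U) \<inter> insert t (I - U) = {}"
        using False disjoint by (auto simp: U_def)
      \<comment> \<open>The new clique part is a clique because it lies inside the neighbourhood of
        the simplicial vertex \<open>t\<close>.\<close>
      have "K - {t} \<union> U \<subseteq> neighbourhood G t"
        using K_adjacent[OF tK] by (auto simp: U_def)
      then show "clique G (K - {t} \<union> U)"
        using nbrs neighbourhood_subset_verts unfolding clique_iff_neighbourhood by blast
      have "v \<notin> neighbourhood G u" if "u \<in> I" "v \<in> I" for u v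
        using neighbourhood_I[OF that(1)] that(2) disjoint by blast
      then show "independent_set G (insert t (I - U))"
        using tK union neighbourhood_sym
        unfolding independent_set_iff_neighbourhood U_def by (auto simp: union[symmetric])
    qed
  qed
qed

end

theorem theorem13:
  fixes G :: "('a, 'b) pre_digraph" and t :: 'a
  assumes "graph G" and "connected G" and "split_graph G" and "t \<in> verts G"
  shows "(\<exists>xs. mcs_ordering G xs \<and> last xs = t) \<longleftrightarrow>
    simplicial G t \<and>
    chain_subset (neighbourhood G ` {v \<in> verts G. out_degree G v < out_degree G t})"
proof -
  from assms(3)[unfolded split_graph_def] obtain K I
    where "K \<union> I = verts G" "K \<inter> I = {}" "clique G K" "independent_set G I"
    by (elim exE conjE)
  then have KI: "split_partition G K I"
    using assms(1) by (simp add: split_partition_def split_partition_axioms_def)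
  interpret split_partition G K I by (rule KI)
  show ?thesis
  proof
    assume "\<exists>xs. mcs_ordering G xs \<and> last xs = t"
    then obtain xs where xs: "mcs_ordering G xs" "last xs = t" by blast
    have simp: "simplicial G t"
      using simplicial_last_K[OF xs] simplicial_I assms(4) union by blast
    \<comment> \<open>The chain argument wants \<open>t\<close> in the independent part. The
      ordering \<open>xs\<close> does not depend on the partition, so it carries over to
      \<open>K'\<close> and \<open>I'\<close>.\<close>
    obtain K' I' where KI': "split_partition G K' I'" "t \<in> I'"
      using simplicial_in_independent_part[OF simp] .
    show "simplicial G t \<and>
        chain_subset (neighbourhood G ` {v \<in> verts G. out_degree G v < out_degree G t})"
      using simp split_partition.chain_of_smaller_degree[OF KI'(1) xs KI'(2)] by (rule conjI)
  next
    assume rhs: "simplicial G t \<and>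
        chain_subset (neighbourhood G ` {v \<in> verts G. out_degree G v < out_degree G t})"
    obtain K' I' where KI': "split_partition G K' I'" "t \<in> I'"
      using simplicial_in_independent_part[OF conjunct1[OF rhs]] .
    show "\<exists>xs. mcs_ordering G xs \<and> last xs = t"
      by (rule split_partition.mcs_last_if_chain[OF KI' conjunct2[OF rhs]])
  qed
qed

end
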